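(* For every complex $x$ with $\Re(x)>-\frac12$, $$\lim_{N\to\infty}\prod_{k=1}^{2N}\left(1+\frac{2x}{k}\right)^{-k(-1)^k}=\frac{e^{-x}\,\Gamma(x+\frac12)}{\Gamma(\frac12)}\left(\frac{G(x+\frac12)}{G(x+1)\,G(\frac12)}\right)^2 .$$
   Context: $\Gamma$ is the Euler gamma function and $G$ is the Barnes $G$-function, the entire function satisfying $G(z+1)=G(z)\Gamma(z)$, $G(1)=1$ (with the standard normalization: $\frac{d^3}{dx^3}\log G(x)\ge0$ for $x>0$). *)

theory Defs
  imports "HOL-Complex_Analysis.Complex_Analysis"
begin

text \<open>
  The functional equation is guarded because \<^const>\<open>Gamma\<close> is totalized to \<open>0\<close> at its poles;
  at these points the values (zeros) of \<open>G\<close> are determined by continuity.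
  The logarithm of \<open>G\<close> on the positive axis is the real logarithm, so \<open>G\<close> is required to be
  real and positive there.
\<close>

definition is_barnes_G :: "(complex \<Rightarrow> complex) \<Rightarrow> bool" where
  "is_barnes_G G \<longleftrightarrow>
     G holomorphic_on UNIV \<and>
     (\<forall>z. z \<notin> \<int>\<^sub>\<le>\<^sub>0 \<longrightarrow> G (z + 1) = G z * Gamma z) \<and>
     G 1 = 1 \<and>
     (\<forall>x::real. x > 0 \<longrightarrow> G (of_real x) \<in> \<real> \<and> Re (G (of_real x)) > 0) \<and>
     (\<forall>x::real. x > 0 \<longrightarrow> (deriv ^^ 3) (\<lambda>t::real. ln (Re (G (of_real t)))) x \<ge> 0)"

text \<open>
  Exactly one function satisfies \<^const>\<open>is_barnes_G\<close>. Existence: the Weierstrass product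
  \<open>G (1 + z) = (2 * pi) powr (z / 2) * exp (- (z + (1 + euler_mascheroni) * z^2) / 2) *
  (\<Prod>k. (1 + z / k)^k * exp (z^2 / (2 * k) - z))\<close> over \<open>k \<ge> 1\<close>; the third derivative of its
  logarithm is \<open>\<Sum>k. 2 * k / (k + z)^3\<close>. Uniqueness: the difference \<open>p\<close> of two candidate
  logarithms on the positive axis has period 1, and \<open>p''\<close> is a difference of increasing functions
  whose increments over unit steps tend to \<open>0\<close>, so \<open>p''\<close> is constant and \<open>p = 0\<close>.
\<close>

definition barnes_G :: "complex \<Rightarrow> complex" where
  "barnes_G = (THE G. is_barnes_G G)"

end

theory Submission
  imports Defs
begin

text \<open>
  Let \<open>W z = (\<Prod>k\<ge>1. (1 + z / k)^k * exp (z^2 / (2 * k) - z))\<close>. Its partial products satisfy a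
  telescoping shift identity relating \<open>z\<close> and \<open>z - 1\<close>, so that \<open>W z\<close>, times the exponential of a
  quadratic polynomial in \<open>z\<close>, satisfies the functional equation of \<open>G (z + 1)\<close>. The third
  logarithmic derivatives of the partial products are positive sums, which passes to the limit, so
  this function is a Barnes function, and there is only one. In the ratio
  \<open>G (x + 1/2) / (G (x + 1) * G (1/2))\<close> the linear part of the quadratic polynomial cancels, and
  the finite product in question is an exact ratio of partial products of \<open>W\<close> and of Gauss's
  product for \<open>Gamma\<close>.
\<close>

subsection \<open>The Weierstrass product\<close>

text \<open>Built from the elementary factor of genus 2 so that
  \<open>weierstrass_factor_bound\<close> applies to the base of the power. Factor \<open>k\<close>
  belongs to the integer \<open>Suc k\<close>.\<close>

definition barnes_factor :: "nat \<Rightarrow> complex \<Rightarrow> complex" where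
  "barnes_factor k z = weierstrass_factor 2 (- (z / of_nat (Suc k))) ^ Suc k"

definition barnes_partial :: "nat \<Rightarrow> complex \<Rightarrow> complex" where
  "barnes_partial N z = (\<Prod>k<N. barnes_factor k z)"

definition barnes_prod :: "complex \<Rightarrow> complex" where
  "barnes_prod z = (\<Prod>k. barnes_factor k z)"

lemma barnes_factor_altdef:
  "barnes_factor k z = (1 + z / of_nat (Suc k)) ^ Suc k * exp (z\<^sup>2 / (2 * of_nat (Suc k)) - z)"
proof -
  have "exp (\<Sum>i = 1..2. (- (z / of_nat (Suc k))) ^ i / of_nat i) ^ Suc k
      = exp (of_nat (Suc k) * (- (z / of_nat (Suc k)) + (z / of_nat (Suc k))\<^sup>2 / 2))"
    by (subst exp_of_nat_mult [symmetric]) (simp add: numeral_2_eq_2)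
  also have "of_nat (Suc k) * (- (z / of_nat (Suc k)) + (z / of_nat (Suc k))\<^sup>2 / 2)
      = z\<^sup>2 / (2 * of_nat (Suc k)) - z"
    by (simp add: field_simps power2_eq_square del: of_nat_Suc)
  finally show ?thesis
    by (simp add: barnes_factor_def weierstrass_factor_def power_mult_distrib del: power_Suc of_nat_Suc)
qed

lemma barnes_factor_0 [simp]: "barnes_factor k 0 = 1"
  by (simp add: barnes_factor_altdef)

section \<open>Locally uniform convergence of the product\<close>

text \<open>A product of \<open>n\<close> factors \<open>1 + (w - 1)\<close> differs from 1 by at
  most \<open>exp y - 1\<close> with \<open>y = n * norm (w - 1)\<close>, and
  \<open>exp y - 1 \<le> y + y^2 \<le> 2 * y\<close> for \<open>y \<le> 1\<close>.\<close>

lemma norm_power_minus_one_le: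
  fixes w :: complex
  assumes "real n * norm (w - 1) \<le> 1"
  shows "norm (w ^ n - 1) \<le> 2 * (real n * norm (w - 1))"
proof -
  have "norm (w ^ n - 1) = norm ((\<Prod>i<n. 1 + (w - 1)) - 1)"
    by simp
  also have "\<dots> \<le> (\<Prod>i<n. 1 + norm (w - 1)) - 1"
    by (rule norm_prod_minus1_le_prod_minus1)
  also have "\<dots> = (1 + norm (w - 1)) ^ n - 1"
    by simp
  also have "\<dots> \<le> exp (norm (w - 1)) ^ n - 1"
    by (intro diff_right_mono power_mono) auto
  also have "\<dots> = exp (real n * norm (w - 1)) - 1"
    by (simp add: exp_of_nat_mult)
  also have "\<dots> \<le> real n * norm (w - 1) + (real n * norm (w - 1))\<^sup>2"
    using exp_bound[of "real n * norm (w - 1)"] assms by simp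
  also have "(real n * norm (w - 1))\<^sup>2 \<le> real n * norm (w - 1)"
    using assms by (simp add: power2_eq_square mult_left_le)
  finally show ?thesis by simp
qed

text \<open>With \<open>n = Suc k\<close>, the elementary factor is \<open>1 + O((R / n)^3)\<close>,
  and its \<open>n\<close>-th power costs one factor \<open>n\<close>, which leaves a summable
  \<open>O(1 / n^2)\<close>. The first bound on \<open>k\<close> puts \<open>z / n\<close> into the
  disc of radius 1/2, the second makes the power estimate applicable.\<close>

lemma barnes_factor_bound:
  assumes R: "R > 0" and k: "2 * R \<le> real (Suc k)" "3 * R ^ 3 \<le> real (Suc k)" and z: "norm z \<le> R"
  shows "norm (barnes_factor k z - 1) \<le> 6 * R ^ 3 * (1 / real (Suc k) ^ 2)"
proof -
  define n where "n = Suc k"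
  have n: "real n \<ge> 1" "2 * R \<le> real n" "3 * R ^ 3 \<le> real n"
    using k by (auto simp: n_def)
  define w where "w = weierstrass_factor 2 (- (z / of_nat n))"
  have "norm (w - 1) \<le> 3 * norm (- (z / of_nat n)) ^ Suc 2"
    unfolding w_def using n z by (intro weierstrass_factor_bound) (auto simp: norm_divide divide_simps)
  also have "\<dots> = 3 * (norm z / real n) ^ 3"
    by (simp add: norm_divide numeral_3_eq_3)
  also have "\<dots> \<le> 3 * (R / real n) ^ 3"
    using z by (intro mult_left_mono power_mono divide_right_mono) auto
  finally have "real n * norm (w - 1) \<le> real n * (3 * (R / real n) ^ 3)"
    by (intro mult_left_mono) auto
  also have "\<dots> = 3 * R ^ 3 * (1 / real n ^ 2)"
    using n by (simp add: field_simps power2_eq_square power3_eq_cube)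
  finally have *: "real n * norm (w - 1) \<le> 3 * R ^ 3 * (1 / real n ^ 2)" .
  have "3 * R ^ 3 * (1 / real n ^ 2) \<le> real n * (1 / real n ^ 2)"
    using n by (intro mult_right_mono) auto
  also have "\<dots> \<le> 1"
    using n by (simp add: field_simps power2_eq_square)
  finally have "real n * norm (w - 1) \<le> 1"
    using * by linarith
  hence "norm (w ^ n - 1) \<le> 2 * (real n * norm (w - 1))"
    by (rule norm_power_minus_one_le)
  with * show ?thesis
    unfolding barnes_factor_def w_def n_def by simp
qed

text \<open>The doubled norm is the form that the comparison test and the Weierstrass M-test expect
  for the summands \<open>norm (barnes_factor k z - 1)\<close>.\<close>

lemma eventually_barnes_factor_bound:
  assumes "R > 0"
  shows "\<forall>\<^sub>F k in sequentially. \<forall>z\<in>cball 0 R.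
           norm (norm (barnes_factor k z - 1)) \<le> 6 * R ^ 3 * (1 / real (Suc k) ^ 2)"
proof -
  have "\<forall>\<^sub>F k in sequentially. 2 * R \<le> real (Suc k)" "\<forall>\<^sub>F k in sequentially. 3 * R ^ 3 \<le> real (Suc k)"
    by real_asymp+
  thus ?thesis
    by eventually_elim (use barnes_factor_bound assms in auto)
qed

lemma summable_barnes_factor_bound: "summable (\<lambda>k. C * (1 / real (Suc k) ^ 2))"
  using inverse_squares_sums by (intro summable_mult) (auto simp: sums_iff add_ac)

lemma convergent_prod_barnes_factor: "convergent_prod (\<lambda>k. barnes_factor k z)"
proof -
  have "summable (\<lambda>k. norm (barnes_factor k z - 1))"
  proof (rule summable_comparison_test_ev)
    show "\<forall>\<^sub>F k in sequentially. norm (norm (barnes_factor k z - 1))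
            \<le> 6 * (norm z + 1) ^ 3 * (1 / real (Suc k) ^ 2)"
      using eventually_barnes_factor_bound[of "norm z + 1"]
      by (rule eventually_mono) (auto simp: add_nonneg_pos)
  qed (rule summable_barnes_factor_bound)
  thus ?thesis
    by (intro abs_convergent_prod_imp_convergent_prod summable_imp_abs_convergent_prod)
qed

lemma barnes_partial_LIMSEQ: "(\<lambda>N. barnes_partial N z) \<longlonglongrightarrow> barnes_prod z"
proof -
  have "(\<lambda>N. barnes_partial (Suc N) z) \<longlonglongrightarrow> barnes_prod z"
    using convergent_prod_LIMSEQ[OF convergent_prod_barnes_factor[of z]]
    by (simp add: barnes_partial_def barnes_prod_def lessThan_Suc_atMost)
  thus ?thesis by (rule LIMSEQ_imp_Suc)
qed

lemma barnes_partial_Suc: "barnes_partial (Suc N) z = barnes_partial N z * barnes_factor N z"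
  by (simp add: barnes_partial_def)

lemma barnes_factor_nonzero:
  assumes "\<And>n::nat. z \<noteq> - of_nat (Suc n)"
  shows "barnes_factor k z \<noteq> 0"
proof -
  have "1 + z / of_nat (Suc k) \<noteq> 0"
    using assms[of k] by (auto simp: field_simps add_eq_0_iff simp del: of_nat_Suc)
  thus ?thesis by (simp add: barnes_factor_altdef del: power_Suc of_nat_Suc)
qed

lemma barnes_partial_nonzero:
  assumes "\<And>n::nat. z \<noteq> - of_nat (Suc n)"
  shows "barnes_partial N z \<noteq> 0"
  using barnes_factor_nonzero[OF assms] by (simp add: barnes_partial_def)

lemma barnes_prod_nonzero:
  assumes "\<And>n::nat. z \<noteq> - of_nat (Suc n)"
  shows "barnes_prod z \<noteq> 0"
  unfolding barnes_prod_def
  by (intro prodinf_nonzero convergent_prod_barnes_factor barnes_factor_nonzero assms)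

lemma barnes_partial_holomorphic [holomorphic_intros]:
  "f holomorphic_on A \<Longrightarrow> (\<lambda>z. barnes_partial N (f z)) holomorphic_on A"
  unfolding barnes_partial_def barnes_factor_def by (intro holomorphic_intros) auto

text \<open>The M-test makes the sums of \<open>norm (barnes_factor n z - 1)\<close> uniformly
  convergent, hence also the products; the uniform limit must be the pointwise one.\<close>

lemma uniform_limit_barnes_partial:
  assumes "R > 0"
  shows "uniform_limit (cball 0 R) barnes_partial barnes_prod sequentially"
proof -
  have "uniformly_convergent_on (cball 0 R) (\<lambda>N z. \<Prod>k<N. barnes_factor k z)"
  proof (rule uniformly_convergent_on_prod')
    show "uniformly_convergent_on (cball 0 R) (\<lambda>N z. \<Sum>n<N. norm (barnes_factor n z - 1))"
      using eventually_barnes_factor_bound[OF assms] summable_barnes_factor_bound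
      by (rule Weierstrass_m_test'_ev)
  qed (auto simp: barnes_factor_def intro!: continuous_intros simp del: power_Suc of_nat_Suc)
  then obtain g where g: "uniform_limit (cball 0 R) barnes_partial g sequentially"
    unfolding uniformly_convergent_on_def barnes_partial_def by blast
  moreover have "g z = barnes_prod z" if "z \<in> cball 0 R" for z
    using tendsto_uniform_limitI[OF g that] barnes_partial_LIMSEQ LIMSEQ_unique by blast
  ultimately show ?thesis
    by (metis (no_types, lifting) uniform_limit_cong')
qed

lemma barnes_prod_holomorphic: "barnes_prod holomorphic_on UNIV"
proof (rule holomorphic_uniform_sequence)
  fix z :: complex
  have "uniform_limit (cball z 1) barnes_partial barnes_prod sequentially"
    by (rule uniform_limit_on_subset[OF uniform_limit_barnes_partial[of "norm z + 1"]])
       (auto simp: cball_subset_cball_iff add_nonneg_pos)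
  thus "\<exists>d>0. cball z d \<subseteq> UNIV \<and> uniform_limit (cball z d) barnes_partial barnes_prod sequentially"
    by (intro exI[of _ 1]) auto
qed (auto intro!: holomorphic_intros)

section \<open>The shift identity and its limit\<close>

text \<open>The factors of a convergent product tend to 1; removing the exponential from
  \<open>barnes_factor\<close> leaves exactly this power.\<close>

lemma exp_limit_complex: "(\<lambda>N. (1 + z / of_nat N) ^ N) \<longlonglongrightarrow> exp (z::complex)"
proof -
  have "(\<lambda>k. barnes_factor k z * exp (z - z\<^sup>2 / (2 * of_nat (Suc k)))) \<longlonglongrightarrow> 1 * exp (z - 0)"
  proof (intro tendsto_intros convergent_prod_imp_LIMSEQ convergent_prod_barnes_factor)
    show "(\<lambda>k. z\<^sup>2 / (2 * complex_of_nat (Suc k))) \<longlonglongrightarrow> 0"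
      using tendsto_mult[OF tendsto_const[of "z\<^sup>2 / 2"] LIMSEQ_Suc[OF lim_1_over_n]]
      by (simp del: of_nat_Suc)
  qed
  also have "(\<lambda>k. barnes_factor k z * exp (z - z\<^sup>2 / (2 * of_nat (Suc k))))
      = (\<lambda>k. (1 + z / of_nat (Suc k)) ^ Suc k)"
    by (simp add: barnes_factor_altdef mult.assoc exp_add [symmetric] del: power_Suc of_nat_Suc)
  finally show ?thesis
    using filterlim_sequentially_Suc[of "\<lambda>N. (1 + z / of_nat N) ^ N"] by simp
qed

text \<open>The numerators at \<open>z\<close> and \<open>z - 1\<close> telescope up to the boundary
  power \<open>(N + z)^N\<close> and the Pochhammer symbol. In the exponents,
  \<open>z^2 - (z - 1)^2 = 2 * z - 1\<close> produces the harmonic sum and the linear parts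
  contribute -1 per factor.\<close>

lemma barnes_partial_shift:
  "barnes_partial N z * pochhammer z N =
     barnes_partial N (z - 1) * (of_nat N + z) ^ N * exp ((2 * z - 1) * harm N / 2 - of_nat N)"
proof (induction N)
  case 0
  then show ?case by (simp add: barnes_partial_def harm_def)
next
  case (Suc N)
  define n :: complex where "n = of_nat (Suc N)"
  have n: "n \<noteq> 0" "of_nat N = n - 1" by (simp_all add: n_def del: of_nat_Suc) simp
  have sh: "1 + z / n = (n + z) / n" "1 + (z - 1) / n = (n + z - 1) / n"
    using n by (simp_all add: field_simps)
  have fac: "barnes_factor N z = (n + z) ^ Suc N / n ^ Suc N * exp (z\<^sup>2 / (2 * n) - z)"
    "barnes_factor N (z - 1) = (n + z - 1) ^ Suc N / n ^ Suc N * exp ((z - 1)\<^sup>2 / (2 * n) - (z - 1))"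
    unfolding barnes_factor_altdef n_def [symmetric] sh power_divide by simp_all
  have ex: "z\<^sup>2 / (2 * n) - z + ((2 * z - 1) * harm N / 2 - (n - 1)) =
     ((z - 1)\<^sup>2 / (2 * n) - (z - 1)) + ((2 * z - 1) * harm (Suc N) / 2 - n)"
    using n by (simp add: harm_Suc n_def [symmetric] field_simps power2_eq_square del: of_nat_Suc)
  have "barnes_partial (Suc N) z * pochhammer z (Suc N)
      = (barnes_partial N z * pochhammer z N) * (z + n - 1) * barnes_factor N z"
    by (simp add: barnes_partial_Suc pochhammer_Suc n)
  also have "\<dots> = barnes_partial N (z - 1) * ((n - 1 + z) ^ N * (z + n - 1)) * ((n + z) ^ Suc N / n ^ Suc N) *
      exp (z\<^sup>2 / (2 * n) - z + ((2 * z - 1) * harm N / 2 - (n - 1)))"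
    unfolding Suc.IH fac exp_add n by (simp add: mult_ac)
  \<comment> \<open>The new Pochhammer factor completes the old boundary power to the numerator of
    the new factor at \<open>z - 1\<close>.\<close>
  also have "(n - 1 + z) ^ N * (z + n - 1) = (n + z - 1) ^ Suc N"
    by (simp add: algebra_simps)
  also have "barnes_partial N (z - 1) * (n + z - 1) ^ Suc N * ((n + z) ^ Suc N / n ^ Suc N) *
      exp (z\<^sup>2 / (2 * n) - z + ((2 * z - 1) * harm N / 2 - (n - 1)))
     = (barnes_partial N (z - 1) * barnes_factor N (z - 1)) * (n + z) ^ Suc N *
       exp ((2 * z - 1) * harm (Suc N) / 2 - n)"
    unfolding ex fac exp_add by (simp add: mult_ac del: power_Suc)
  finally show ?case
    by (simp only: barnes_partial_Suc n_def)
qed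

lemma barnes_partial_0 [simp]: "barnes_partial N 0 = 1"
  by (simp add: barnes_partial_def)

lemma harm_minus_ln_LIMSEQ:
  "(\<lambda>n. harm n - of_real (ln (real n)) :: complex) \<longlonglongrightarrow> of_real euler_mascheroni"
  using tendsto_of_real[OF euler_mascheroni_LIMSEQ, where ?'a = complex]
  by (simp add: of_real_harm)

text \<open>
  Dividing the shift identity by its instance at \<open>z = 1\<close> cancels the factor \<open>N ^ N * exp (- N)\<close>,
  so that Stirling's formula is not needed.
\<close>
lemma barnes_prod_shift:
  assumes z: "z \<notin> \<int>\<^sub>\<le>\<^sub>0"
  shows "barnes_prod z =
    barnes_prod (z - 1) * barnes_prod 1 * Gamma z * exp ((1 + of_real euler_mascheroni) * (z - 1))"
proof -
  have eq: "barnes_partial N z = barnes_partial N (z - 1) * barnes_partial N 1 *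
       ((1 + z / of_nat N) ^ N / (1 + 1 / of_nat N) ^ N) * Gamma_series' z N *
       exp ((z - 1) * (harm N - of_real (ln (real N))))" if N: "N > 0" for N
  proof -
    define P where "P = pochhammer z N"
    have P: "P \<noteq> 0"
      using z by (auto simp: P_def dest: pochhammer_eq_0_imp_nonpos_Int)
    define n :: complex where "n = of_nat N"
    have n: "n \<noteq> 0" "n + 1 \<noteq> 0"
      using N of_nat_neq_0[of N, where ?'a = complex] by (simp_all add: n_def add.commute)
    \<comment> \<open>\<open>E\<close> is the exponential of the shift identity at
      \<open>z = 1\<close>; it cancels between the two instances.\<close>
    define E where "E = exp (harm N / 2 - n)"
    have z1: "barnes_partial N z * P = barnes_partial N (z - 1) * (n + z) ^ N * (exp ((z - 1) * harm N) * E)"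
      using barnes_partial_shift[of N z] by (simp add: P_def n_def E_def flip: exp_add) (simp add: field_simps)
    have z2: "barnes_partial N 1 * fact N = (n + 1) ^ N * E"
      using barnes_partial_shift[of N 1] by (simp add: n_def E_def pochhammer_fact [symmetric])
    have f: "fact N = n * fact (N - 1)"
      using N by (simp add: n_def fact_reduce)
    have l: "exp (of_real (ln (real N))) = n"
      using N by (simp add: n_def exp_of_real)
    \<comment> \<open>\<open>Gamma_series'\<close> carries \<open>(N - 1)!\<close> and
      \<open>N^z\<close>. Multiplying by \<open>N^(1 - z)\<close> leaves one factor
      \<open>N\<close>, which turns \<open>(N - 1)!\<close> into \<open>N!\<close>.\<close>
    have G: "Gamma_series' z N * exp ((z - 1) * (harm N - of_real (ln (real N)))) = fact N * exp ((z - 1) * harm N) / P"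
      using n by (simp add: Gamma_series'_def P_def f ring_distribs exp_diff exp_add l mult_ac)
    have pw: "(1 + z / n) ^ N / (1 + 1 / n) ^ N = (n + z) ^ N / (n + 1) ^ N"
    proof -
      have "1 + z / n = (n + z) / n" "1 + 1 / n = (n + 1) / n"
        using n by (simp_all add: field_simps)
      thus ?thesis using n by (simp add: power_divide)
    qed
    have "barnes_partial N (z - 1) * barnes_partial N 1 *
       ((1 + z / n) ^ N / (1 + 1 / n) ^ N) * Gamma_series' z N * exp ((z - 1) * (harm N - of_real (ln (real N))))
      = barnes_partial N (z - 1) * (barnes_partial N 1 * fact N) * ((n + z) ^ N / (n + 1) ^ N) * exp ((z - 1) * harm N) / P"
      unfolding pw mult.assoc G by simp
    also have "\<dots> = barnes_partial N (z - 1) * (n + z) ^ N * (exp ((z - 1) * harm N) * E) / P"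
      unfolding z2 using n by (simp add: field_simps)
    also have "\<dots> = barnes_partial N z"
      unfolding z1 [symmetric] using P by simp
    finally show ?thesis by (simp add: n_def)
  qed
  have "(\<lambda>N. barnes_partial N (z - 1) * barnes_partial N 1 *
       ((1 + z / of_nat N) ^ N / (1 + 1 / of_nat N) ^ N) * Gamma_series' z N *
       exp ((z - 1) * (harm N - of_real (ln (real N)))))
     \<longlonglongrightarrow> barnes_prod (z - 1) * barnes_prod 1 * (exp z / exp 1) * Gamma z * exp ((z - 1) * of_real euler_mascheroni)"
    by (intro tendsto_intros barnes_partial_LIMSEQ exp_limit_complex Gamma_series'_LIMSEQ
          harm_minus_ln_LIMSEQ) auto
  moreover have "\<forall>\<^sub>F N in sequentially. barnes_partial N (z - 1) * barnes_partial N 1 *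
       ((1 + z / of_nat N) ^ N / (1 + 1 / of_nat N) ^ N) * Gamma_series' z N *
       exp ((z - 1) * (harm N - of_real (ln (real N)))) = barnes_partial N z"
    using eventually_gt_at_top[of 0] by eventually_elim (simp add: eq)
  ultimately have "(\<lambda>N. barnes_partial N z) \<longlonglongrightarrow>
     barnes_prod (z - 1) * barnes_prod 1 * (exp z / exp 1) * Gamma z * exp ((z - 1) * of_real euler_mascheroni)"
    by (rule Lim_transform_eventually)
  hence "barnes_prod z =
     barnes_prod (z - 1) * barnes_prod 1 * (exp z / exp 1) * Gamma z * exp ((z - 1) * of_real euler_mascheroni)"
    using barnes_partial_LIMSEQ LIMSEQ_unique by blast
  also have "\<dots> = barnes_prod (z - 1) * barnes_prod 1 * Gamma z *
      exp (z - 1 + (z - 1) * of_real euler_mascheroni)"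
    unfolding exp_add exp_diff by simp
  finally show ?thesis
    by (simp add: algebra_simps)
qed

subsection \<open>Logarithmic derivatives on the positive axis\<close>

text \<open>\<open>deriv\<close> depends only on the function near the point, so formulas valid on
  an open set can be differentiated successively there.\<close>

lemma deriv_3_eq:
  fixes f :: "real \<Rightarrow> real"
  assumes S: "open S" "x \<in> S"
    and f: "\<And>t. t \<in> S \<Longrightarrow> (f has_real_derivative f1 t) (at t)"
    and f1: "\<And>t. t \<in> S \<Longrightarrow> (f1 has_real_derivative f2 t) (at t)"
    and f2: "\<And>t. t \<in> S \<Longrightarrow> (f2 has_real_derivative f3 t) (at t)"
  shows "(deriv ^^ 3) f x = f3 x"
proof -
  have ev: "\<forall>\<^sub>F u in nhds t. u \<in> S" if "t \<in> S" for t
    using S(1) that by (rule eventually_nhds_in_open)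
  have d1: "deriv f t = f1 t" if "t \<in> S" for t
    using f[OF that] by (rule DERIV_imp_deriv)
  have d2: "deriv (deriv f) t = f2 t" if "t \<in> S" for t
  proof -
    have "deriv (deriv f) t = deriv f1 t"
      by (rule deriv_cong_ev[OF eventually_mono[OF ev[OF that] d1] refl])
    also have "\<dots> = f2 t"
      using f1[OF that] by (rule DERIV_imp_deriv)
    finally show ?thesis .
  qed
  have "deriv (deriv (deriv f)) x = deriv f2 x"
    by (rule deriv_cong_ev[OF eventually_mono[OF ev[OF S(2)] d2] refl])
  also have "\<dots> = f3 x"
    using f2[OF S(2)] by (rule DERIV_imp_deriv)
  finally show ?thesis by (simp add: numeral_3_eq_3)
qed

lemma DERIV_ln_three:
  fixes h0 :: "real \<Rightarrow> real"
  assumes "h0 t > 0"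
    and "(h0 has_real_derivative h1 t) (at t)" "(h1 has_real_derivative h2 t) (at t)"
      "(h2 has_real_derivative h3) (at t)"
  shows "((\<lambda>t. ln (h0 t)) has_real_derivative h1 t / h0 t) (at t)"
    and "((\<lambda>t. h1 t / h0 t) has_real_derivative h2 t / h0 t - (h1 t / h0 t)\<^sup>2) (at t)"
    and "((\<lambda>t. h2 t / h0 t - (h1 t / h0 t)\<^sup>2) has_real_derivative
            h3 / h0 t - 3 * h1 t * h2 t / (h0 t)\<^sup>2 + 2 * (h1 t / h0 t) ^ 3) (at t)"
  using assms
  by (auto intro!: derivative_eq_intros simp: field_simps power2_eq_square power3_eq_cube)

text \<open>Differentiation takes place in the complex plane, so that derivatives of all orders pass
  to uniform limits of holomorphic functions.\<close>

definition real_deriv :: "(complex \<Rightarrow> complex) \<Rightarrow> nat \<Rightarrow> real \<Rightarrow> real" where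
  "real_deriv F n t = Re ((deriv ^^ n) F (of_real t))"

text \<open>This and the next two definitions are the successive derivatives of
  \<open>ln (Re (F t))\<close>, spelled out in the derivatives of \<open>F\<close> so that limits
  can be taken termwise.\<close>

definition ln_deriv1 :: "(complex \<Rightarrow> complex) \<Rightarrow> real \<Rightarrow> real" where
  "ln_deriv1 F t = real_deriv F 1 t / real_deriv F 0 t"

definition ln_deriv2 :: "(complex \<Rightarrow> complex) \<Rightarrow> real \<Rightarrow> real" where
  "ln_deriv2 F t = real_deriv F 2 t / real_deriv F 0 t - (real_deriv F 1 t / real_deriv F 0 t)\<^sup>2"

definition ln_deriv3 :: "(complex \<Rightarrow> complex) \<Rightarrow> real \<Rightarrow> real" where
  "ln_deriv3 F t = real_deriv F 3 t / real_deriv F 0 t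
     - 3 * real_deriv F 1 t * real_deriv F 2 t / (real_deriv F 0 t)\<^sup>2
     + 2 * (real_deriv F 1 t / real_deriv F 0 t) ^ 3"

lemma real_deriv_0 [simp]: "real_deriv F 0 t = Re (F (of_real t))"
  by (simp add: real_deriv_def)

lemma DERIV_real_deriv:
  assumes "F holomorphic_on UNIV"
  shows "(real_deriv F n has_real_derivative real_deriv F (Suc n) t) (at t)"
proof -
  have "((deriv ^^ n) F has_field_derivative (deriv ^^ Suc n) F (of_real t)) (at (of_real t))"
    using holomorphic_derivI[OF holomorphic_higher_deriv[OF assms open_UNIV] open_UNIV] by simp
  thus ?thesis
    unfolding real_deriv_def by (intro has_field_derivative_Re has_vector_derivative_real_field)
qed

lemma DERIV_ln_real:
  assumes F: "F holomorphic_on UNIV" and pos: "Re (F (of_real t)) > 0"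
  shows "((\<lambda>t. ln (Re (F (of_real t)))) has_real_derivative ln_deriv1 F t) (at t)"
    and "(ln_deriv1 F has_real_derivative ln_deriv2 F t) (at t)"
    and "(ln_deriv2 F has_real_derivative ln_deriv3 F t) (at t)"
proof -
  have d: "(real_deriv F 0 has_real_derivative real_deriv F 1 t) (at t)"
    "(real_deriv F 1 has_real_derivative real_deriv F 2 t) (at t)"
    "(real_deriv F 2 has_real_derivative real_deriv F 3 t) (at t)"
    using DERIV_real_deriv[OF F, of 0 t] DERIV_real_deriv[OF F, of 1 t] DERIV_real_deriv[OF F, of 2 t]
    by (simp_all add: numeral_2_eq_2 numeral_3_eq_3)
  have "real_deriv F 0 t > 0"
    using pos by simp
  note * = DERIV_ln_three[OF this d]
  show "((\<lambda>t. ln (Re (F (of_real t)))) has_real_derivative ln_deriv1 F t) (at t)"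
    using *(1) by (simp add: ln_deriv1_def)
  show "(ln_deriv1 F has_real_derivative ln_deriv2 F t) (at t)"
    using *(2) by (simp add: ln_deriv1_def[abs_def] ln_deriv2_def)
  show "(ln_deriv2 F has_real_derivative ln_deriv3 F t) (at t)"
    using *(3) by (simp add: ln_deriv2_def[abs_def] ln_deriv3_def)
qed

lemma deriv_3_ln_real:
  assumes F: "F holomorphic_on UNIV" and pos: "\<And>t. t > 0 \<Longrightarrow> Re (F (of_real t)) > 0" and "x > 0"
  shows "(deriv ^^ 3) (\<lambda>t. ln (Re (F (of_real t)))) x = ln_deriv3 F x"
proof (rule deriv_3_eq)
  show "open {0::real<..}" "x \<in> {0<..}"
    using \<open>x > 0\<close> by auto
next
  fix t :: real assume "t \<in> {0<..}"
  hence "Re (F (of_real t)) > 0" using pos by simp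
  from DERIV_ln_real[OF F this]
  show "((\<lambda>t. ln (Re (F (of_real t)))) has_real_derivative ln_deriv1 F t) (at t)"
    "(ln_deriv1 F has_real_derivative ln_deriv2 F t) (at t)"
    "(ln_deriv2 F has_real_derivative ln_deriv3 F t) (at t)" .
qed

subsection \<open>Uniqueness of the Barnes function\<close>

text \<open>
  Two solutions differ by a function of period 1 whose second derivative is a difference of
  increasing functions. Over unit steps these increase by \<open>Polygamma 1 t\<close>, which tends to 0 along
  \<open>t + n\<close>, so this second derivative is constant.
\<close>
locale third_convex_solution =
  fixes f f1 f2 f3 :: "real \<Rightarrow> real"
  assumes deriv: "\<And>t. t > 0 \<Longrightarrow> (f has_real_derivative f1 t) (at t)"
    "\<And>t. t > 0 \<Longrightarrow> (f1 has_real_derivative f2 t) (at t)"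
    "\<And>t. t > 0 \<Longrightarrow> (f2 has_real_derivative f3 t) (at t)"
  and nonneg: "\<And>t. t > 0 \<Longrightarrow> f3 t \<ge> 0"
  and step: "\<And>t. t > 0 \<Longrightarrow> f (t + 1) = f t + ln_Gamma t"
  and one: "f 1 = 0"
begin

lemma step1: "t > 0 \<Longrightarrow> f1 (t + 1) = f1 t + Digamma t"
proof -
  assume t: "t > 0"
  have "((\<lambda>t. f (t + 1)) has_real_derivative f1 (t + 1)) (at t)"
    using DERIV_shift deriv(1)[of "t + 1"] t by fastforce
  moreover have "((\<lambda>t. f (t + 1)) has_real_derivative f1 t + Digamma t) (at t)"
  proof (subst DERIV_cong_ev[OF refl _ refl])
    show "((\<lambda>t. f t + ln_Gamma t) has_real_derivative f1 t + Digamma t) (at t)"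
      using t by (intro DERIV_add deriv has_field_derivative_ln_Gamma_real)
    show "\<forall>\<^sub>F t in nhds t. f (t + 1) = f t + ln_Gamma t"
      using eventually_nhds_in_open[of "{0<..}" t] t by (auto elim!: eventually_mono simp: step)
  qed
  ultimately show ?thesis by (rule DERIV_unique)
qed

lemma step2: "t > 0 \<Longrightarrow> f2 (t + 1) = f2 t + Polygamma 1 t"
proof -
  assume t: "t > 0"
  have "((\<lambda>t. f1 (t + 1)) has_real_derivative f2 (t + 1)) (at t)"
    using DERIV_shift deriv(2)[of "t + 1"] t by fastforce
  moreover have "((\<lambda>t. f1 (t + 1)) has_real_derivative f2 t + Polygamma 1 t) (at t)"
  proof (subst DERIV_cong_ev[OF refl _ refl])
    show "((\<lambda>t. f1 t + Digamma t) has_real_derivative f2 t + Polygamma 1 t) (at t)"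
      using t by (auto intro!: derivative_eq_intros deriv dest: nonpos_Ints_nonpos)
    show "\<forall>\<^sub>F t in nhds t. f1 (t + 1) = f1 t + Digamma t"
      using eventually_nhds_in_open[of "{0<..}" t] t by (auto elim!: eventually_mono simp: step1)
  qed
  ultimately show ?thesis by (rule DERIV_unique)
qed

lemma mono2: "\<lbrakk>0 < s; s \<le> t\<rbrakk> \<Longrightarrow> f2 s \<le> f2 t"
  using deriv(3) nonneg by (intro DERIV_nonneg_imp_nondecreasing[of s t f2]) (meson less_le_trans)+

end

lemma periodic_add_nat:
  fixes p :: "real \<Rightarrow> real"
  assumes "\<And>t. t > 0 \<Longrightarrow> p (t + 1) = p t" "t > 0"
  shows "p (t + real n) = p t"
proof (induction n)
  case (Suc n)
  thus ?case using assms(1)[of "t + real n"] assms(2) by (simp add: add_ac)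
qed simp

text \<open>\<open>Polygamma 1 (t + n)\<close> is a tail of the convergent series of
  \<open>1 / (t + k)^2\<close>.\<close>

lemma Polygamma_1_shift_LIMSEQ:
  assumes "(t::real) > 0"
  shows "(\<lambda>n. Polygamma 1 (t + real n)) \<longlonglongrightarrow> 0"
proof -
  have "(\<lambda>k. inverse ((t + real k) ^ Suc 1)) sums Polygamma 1 t"
    using Polygamma_LIMSEQ[of t 1] assms by simp
  hence "(\<lambda>n. Polygamma 1 t - (\<Sum>k<n. inverse ((t + real k) ^ Suc 1))) \<longlonglongrightarrow> Polygamma 1 t - Polygamma 1 t"
    unfolding sums_def by (intro tendsto_intros)
  moreover have "Polygamma 1 (t + real n) = Polygamma 1 t - (\<Sum>k<n. inverse ((t + real k) ^ Suc 1))" for n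
    using Polygamma_plus_of_nat[of n t 1] assms by (simp add: field_simps)
  ultimately show ?thesis by simp
qed

text \<open>The difference has period 1, so both points may be moved right by \<open>n\<close>.
  There the increase of \<open>g2\<close> is dropped by monotonicity, and that of \<open>f2\<close>
  is at most its increase over a whole unit step, which tends to 0. Exchanging \<open>f\<close> and
  \<open>g\<close> gives the reverse inequality.\<close>

lemma third_convex_solution_second_diff_le:
  assumes f: "third_convex_solution f f1 f2 f3" and g: "third_convex_solution g g1 g2 g3"
    and st: "0 < s" "s \<le> t" "t \<le> s + 1"
  shows "f2 t - g2 t \<le> f2 s - g2 s"
proof -
  interpret f: third_convex_solution f f1 f2 f3 by fact
  interpret g: third_convex_solution g g1 g2 g3 by fact
  define q where "q = (\<lambda>t. f2 t - g2 t)"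
  have q: "q (u + real n) = q u" if "u > 0" for u n
    by (rule periodic_add_nat) (use that in \<open>auto simp: q_def f.step2 g.step2\<close>)
  have "q t - q s \<le> Polygamma 1 (s + real n)" for n
  proof -
    have "q t - q s = q (t + real n) - q (s + real n)"
      using q st by simp
    also have "\<dots> \<le> f2 (t + real n) - f2 (s + real n)"
      using g.mono2[of "s + real n" "t + real n"] st by (simp add: q_def)
    also have "\<dots> \<le> f2 (s + real n + 1) - f2 (s + real n)"
      using f.mono2[of "t + real n" "s + real n + 1"] st by simp
    also have "\<dots> = Polygamma 1 (s + real n)"
      using f.step2[of "s + real n"] st by simp
    finally show ?thesis .
  qed
  hence "q t - q s \<le> 0"
    by (intro LIMSEQ_le_const[OF Polygamma_1_shift_LIMSEQ[OF st(1)]]) auto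
  thus ?thesis by (simp add: q_def)
qed

text \<open>By the mean value theorem on \<open>[1, 2]\<close>, \<open>c\<close> equals
  \<open>p 2 - p 1\<close>, which periodicity makes 0.\<close>

lemma periodic_deriv_const_imp_const:
  fixes p :: "real \<Rightarrow> real"
  assumes p: "\<And>t. t > 0 \<Longrightarrow> (p has_real_derivative c) (at t)" "\<And>t. t > 0 \<Longrightarrow> p (t + 1) = p t" and "t > 0"
  shows "c = 0" "p t = p 1"
proof -
  show c: "c = 0"
    using MVT2[of 1 2 p "\<lambda>_. c"] p(1) p(2)[of 1] by auto
  show "p t = p 1"
    using p(1) c \<open>t > 0\<close> by (intro DERIV_isconst3[of 0 "t + 2" t 1]) auto
qed

lemma third_convex_solution_unique:
  assumes f: "third_convex_solution f f1 f2 f3" and g: "third_convex_solution g g1 g2 g3"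
    and t: "0 < t"
  shows "f t = g t"
proof -
  interpret f: third_convex_solution f f1 f2 f3 by fact
  interpret g: third_convex_solution g g1 g2 g3 by fact
  define p p1 q where "p = (\<lambda>t. f t - g t)" "p1 = (\<lambda>t. f1 t - g1 t)" "q = (\<lambda>t. f2 t - g2 t)"
  note defs = this
  have loc: "q t = q s" if "0 < s" "s \<le> t" "t \<le> s + 1" for s t
    using third_convex_solution_second_diff_le[OF f g that]
      third_convex_solution_second_diff_le[OF g f that] by (simp add: defs)
  have qc: "q t = q 1" if "t > 0" for t
  proof (cases "t \<le> 1")
    case True
    thus ?thesis using loc[of t 1] that by simp
  next
    case False
    \<comment> \<open>\<open>1 + n\<close> is the last point of \<open>1, 2, 3, ...\<close> not
      exceeding \<open>t\<close>, so \<open>t\<close> lies within one unit of it; periodicity then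
      leads back to 1.\<close>
    define n where "n = nat \<lfloor>t - 1\<rfloor>"
    have n: "1 + real n \<le> t" "t \<le> 1 + real n + 1"
      using False unfolding n_def by linarith+
    have "q t = q (1 + real n)"
      using n by (intro loc) auto
    also have "\<dots> = q 1"
      by (rule periodic_add_nat) (auto simp: defs f.step2 g.step2)
    finally show ?thesis .
  qed
  \<comment> \<open>Constancy now descends: \<open>p1\<close> has constant derivative and period 1,
    hence is constant, and the same argument applies to \<open>p\<close>, which vanishes at
    1.\<close>
  have p1: "(p1 has_real_derivative q 1) (at t)" "p1 (t + 1) = p1 t" if "t > 0" for t
    using DERIV_diff[OF f.deriv(2)[OF that] g.deriv(2)[OF that]] that qc[OF that]
    by (auto simp: defs f.step1 g.step1)
  have p1c: "p1 t = p1 1" if "t > 0" for t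
    using periodic_deriv_const_imp_const(2)[OF p1 that] .
  have p: "(p has_real_derivative p1 1) (at t)" "p (t + 1) = p t" if "t > 0" for t
    using DERIV_diff[OF f.deriv(1)[OF that] g.deriv(1)[OF that]] that p1c[OF that]
    by (auto simp: defs f.step g.step)
  show ?thesis
    using periodic_deriv_const_imp_const(2)[OF p t] f.one g.one by (simp add: defs)
qed

section \<open>From the positive axis to entire functions\<close>

lemma is_barnes_G_third_convex_solution:
  assumes "is_barnes_G G"
  shows "third_convex_solution (\<lambda>t. ln (Re (G (of_real t)))) (ln_deriv1 G) (ln_deriv2 G) (ln_deriv3 G)"
proof
  have hol: "G holomorphic_on UNIV"
    and fe: "\<And>z. z \<notin> \<int>\<^sub>\<le>\<^sub>0 \<Longrightarrow> G (z + 1) = G z * Gamma z"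
    and one: "G 1 = 1"
    and re: "\<And>x. x > 0 \<Longrightarrow> G (of_real x) \<in> \<real>"
    and pos: "\<And>x. x > 0 \<Longrightarrow> Re (G (of_real x)) > 0"
    and d3: "\<And>x. x > 0 \<Longrightarrow> (deriv ^^ 3) (\<lambda>t. ln (Re (G (of_real t)))) x \<ge> 0"
    using assms unfolding is_barnes_G_def by blast+
  show "ln (Re (G (of_real 1))) = 0"
    by (simp add: one)
  fix t :: real assume t: "t > 0"
  show "((\<lambda>t. ln (Re (G (of_real t)))) has_real_derivative ln_deriv1 G t) (at t)"
    "(ln_deriv1 G has_real_derivative ln_deriv2 G t) (at t)"
    "(ln_deriv2 G has_real_derivative ln_deriv3 G t) (at t)"
    using DERIV_ln_real[OF hol pos[OF t]] .
  show "ln_deriv3 G t \<ge> 0"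
    using d3[OF t] deriv_3_ln_real[OF hol pos t] by simp
  have "complex_of_real t \<notin> \<int>\<^sub>\<le>\<^sub>0"
    using t by (auto simp: of_real_in_nonpos_Ints_iff dest: nonpos_Ints_nonpos)
  from fe[OF this] have "Re (G (of_real (t + 1))) = Re (G (of_real t)) * Gamma t"
    by (simp add: Gamma_complex_of_real)
  thus "ln (Re (G (of_real (t + 1)))) = ln (Re (G (of_real t))) + ln_Gamma t"
    using pos[OF t] t less_imp_neq[OF Gamma_real_pos[OF t]] by (auto simp: ln_mult ln_Gamma_real_pos)
qed

text \<open>Equal logarithms determine the real positive values on the positive axis, and the
  identity theorem extends the equality to the plane.\<close>

lemma is_barnes_G_unique:
  assumes F: "is_barnes_G F" and G: "is_barnes_G G"
  shows "F = G"
proof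
  fix z
  have eq: "F (of_real t) = G (of_real t)" if t: "t > 0" for t
  proof -
    have "ln (Re (F (of_real t))) = ln (Re (G (of_real t)))"
      using third_convex_solution_unique[OF is_barnes_G_third_convex_solution[OF F]
          is_barnes_G_third_convex_solution[OF G] t] .
    moreover have "Re (F (of_real t)) > 0" "Re (G (of_real t)) > 0"
      "F (of_real t) \<in> \<real>" "G (of_real t) \<in> \<real>"
      using F G t unfolding is_barnes_G_def by blast+
    ultimately show ?thesis
      by (simp add: complex_eq_iff complex_is_Real_iff)
  qed
  have lim: "1 islimpt (complex_of_real ` {0<..})"
  proof -
    have "(\<lambda>n. complex_of_real (1 + inverse (real (Suc n)))) \<longlonglongrightarrow> of_real (1 + 0)"
      by (intro tendsto_intros LIMSEQ_inverse_real_of_nat)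
    moreover have "complex_of_real (1 + inverse (real (Suc n))) \<in> complex_of_real ` {0<..} - {1}" for n
      by (intro DiffI imageI) (auto simp: add_pos_pos simp del: of_nat_Suc of_real_add)
    ultimately show ?thesis
      unfolding islimpt_sequential by (intro exI[of _ "\<lambda>n. complex_of_real (1 + inverse (real (Suc n)))"]) auto
  qed
  have "F z - G z = 0"
    by (rule analytic_continuation[of "\<lambda>z. F z - G z" UNIV _ 1, OF _ _ _ _ _ lim])
       (use F G eq in \<open>auto intro!: holomorphic_intros simp: is_barnes_G_def\<close>)
  thus "F z = G z" by simp
qed

subsection \<open>Existence of the Barnes function\<close>

text \<open>
  The linear coefficient contains \<open>- ln (W 1)\<close> to absorb the factor \<open>W 1\<close> in the shift identity for
  \<open>W\<close>; its closed form in terms of \<open>ln (2 * pi)\<close> is irrelevant.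
\<close>
definition barnes_prefactor :: "complex \<Rightarrow> complex" where
  "barnes_prefactor z = exp (of_real ((1 + euler_mascheroni) / 2 - ln (Re (barnes_prod 1))) * (z - 1)
     - of_real ((1 + euler_mascheroni) / 2) * (z - 1)\<^sup>2)"

definition barnes_G_product :: "complex \<Rightarrow> complex" where
  "barnes_G_product z = barnes_prefactor z * barnes_prod (z - 1)"

text \<open>Finite approximations of the candidate, whose logarithm on the positive axis is an
  explicit finite sum.\<close>

definition barnes_G_partial :: "nat \<Rightarrow> complex \<Rightarrow> complex" where
  "barnes_G_partial N z = barnes_prefactor z * barnes_partial N (z - 1)"

lemma barnes_prefactor_holomorphic [holomorphic_intros]: "barnes_prefactor holomorphic_on A"
  unfolding barnes_prefactor_def by (intro holomorphic_intros)

lemma barnes_G_product_holomorphic: "barnes_G_product holomorphic_on A"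
proof -
  have "(barnes_prod \<circ> (\<lambda>z. z - 1)) holomorphic_on A"
    by (rule holomorphic_on_compose_gen[OF _ barnes_prod_holomorphic]) (auto intro!: holomorphic_intros)
  thus ?thesis
    unfolding barnes_G_product_def[abs_def] o_def by (intro holomorphic_intros)
qed

lemma barnes_G_partial_holomorphic: "barnes_G_partial N holomorphic_on A"
  unfolding barnes_G_partial_def[abs_def] by (intro holomorphic_intros)

lemma barnes_partial_of_real:
  "barnes_partial N (of_real t) = of_real (\<Prod>k<N. (1 + t / real (Suc k)) ^ Suc k * exp (t\<^sup>2 / (2 * real (Suc k)) - t))"
  unfolding barnes_partial_def of_real_prod
  by (intro prod.cong refl) (simp add: barnes_factor_altdef exp_of_real [symmetric] del: power_Suc of_nat_Suc)

text \<open>For \<open>t > -1\<close> the partial products are real and nonnegative, which survives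
  in the limit; strict positivity comes from the nonvanishing of the product.\<close>

lemma barnes_prod_of_real:
  assumes "t > -1"
  shows "barnes_prod (of_real t) \<in> \<real>" "Re (barnes_prod (of_real t)) > 0"
proof -
  show real: "barnes_prod (of_real t) \<in> \<real>"
    by (rule Lim_in_closed_set[OF closed_complex_Reals _ _ barnes_partial_LIMSEQ])
       (auto simp: barnes_partial_of_real)
  have "Re (barnes_prod (of_real t)) \<ge> 0"
  proof (rule LIMSEQ_le_const[OF tendsto_Re[OF barnes_partial_LIMSEQ]], intro exI allI impI)
    fix N
    have "1 + t / real (Suc k) \<ge> 0" for k
      using assms by (simp add: field_simps)
    thus "0 \<le> Re (barnes_partial N (of_real t))"
      unfolding barnes_partial_of_real Re_complex_of_real by (intro prod_nonneg) auto
  qed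
  moreover have "barnes_prod (of_real t) \<noteq> 0"
  proof (rule barnes_prod_nonzero)
    fix n :: nat
    have "t \<noteq> - real (Suc n)" using assms by simp
    thus "complex_of_real t \<noteq> - of_nat (Suc n)"
      by (metis of_real_eq_iff of_real_minus of_real_of_nat_eq)
  qed
  ultimately show "Re (barnes_prod (of_real t)) > 0"
    using real by (auto elim!: Reals_cases)
qed

lemma barnes_prefactor_of_real: "barnes_prefactor (of_real t) =
   of_real (exp (((1 + euler_mascheroni) / 2 - ln (Re (barnes_prod 1))) * (t - 1)
     - ((1 + euler_mascheroni) / 2) * (t - 1)\<^sup>2))"
  by (simp add: barnes_prefactor_def exp_of_real [symmetric])

lemma barnes_G_product_of_real:
  assumes "t > 0"
  shows "barnes_G_product (of_real t) \<in> \<real>" "Re (barnes_G_product (of_real t)) > 0"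
proof -
  have "barnes_prod (of_real t - 1) \<in> \<real>" "Re (barnes_prod (of_real t - 1)) > 0"
    using barnes_prod_of_real[of "t - 1"] assms by simp_all
  thus "barnes_G_product (of_real t) \<in> \<real>" "Re (barnes_G_product (of_real t)) > 0"
    by (auto simp: barnes_G_product_def barnes_prefactor_of_real elim!: Reals_cases)
qed

lemma uniform_limit_barnes_G_partial:
  "uniform_limit (cball w 1) barnes_G_partial barnes_G_product sequentially"
proof -
  \<comment> \<open>One unit for the radius of the disc around \<open>w\<close>, one for the shift
    \<open>z - 1\<close>.\<close>
  define R where "R = norm w + 2"
  have "uniform_limit (cball 0 R) barnes_partial barnes_prod sequentially"
    by (rule uniform_limit_barnes_partial) (simp add: R_def add_nonneg_pos)
  hence lim: "uniform_limit (cball w 1) (\<lambda>N z. barnes_partial N (z - 1)) (\<lambda>z. barnes_prod (z - 1)) sequentially"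
  proof (rule uniform_limit_compose')
    show "(\<lambda>z. z - 1) \<in> cball w 1 \<rightarrow> cball 0 R"
    proof
      fix z assume "z \<in> cball w 1"
      hence "norm (z - w) \<le> 1" by (simp add: dist_norm norm_minus_commute)
      hence "norm z \<le> norm w + 1" using norm_triangle_sub[of z w] by simp
      thus "z - 1 \<in> cball 0 R"
        using norm_triangle_ineq4[of z 1] by (simp add: R_def)
    qed
  qed
  have bnd: "bounded (f ` cball w 1)" if "f holomorphic_on UNIV" for f :: "complex \<Rightarrow> complex"
    using that by (intro compact_imp_bounded compact_continuous_image holomorphic_on_imp_continuous_on)
       (auto intro: holomorphic_on_subset)
  have "(barnes_prod \<circ> (\<lambda>z. z - 1)) holomorphic_on UNIV"
    by (rule holomorphic_on_compose_gen[OF _ barnes_prod_holomorphic]) (auto intro!: holomorphic_intros)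
  hence hol: "(\<lambda>z. barnes_prod (z - 1)) holomorphic_on UNIV"
    by (simp add: o_def)
  show ?thesis
    unfolding barnes_G_partial_def[abs_def] barnes_G_product_def[abs_def]
    by (intro uniform_lim_mult uniform_limit_const lim bnd hol barnes_prefactor_holomorphic)
qed

text \<open>The prefactor and the exponential convergence factors have quadratic logarithms, which
  three derivatives annihilate. Only the terms \<open>Suc k * ln (k + t)\<close> remain, with third
  derivative \<open>2 * Suc k / (k + t)^3\<close>.\<close>

lemma ln_deriv3_barnes_G_partial_nonneg:
  assumes "t > 0"
  shows "ln_deriv3 (barnes_G_partial N) t \<ge> 0"
proof -
  define a b :: real where "a = (1 + euler_mascheroni) / 2 - ln (Re (barnes_prod 1))"
    and "b = (1 + euler_mascheroni) / 2"
  define f where "f = (\<lambda>k t. (1 + (t - 1) / real (Suc k)) ^ Suc k * exp ((t - 1)\<^sup>2 / (2 * real (Suc k)) - (t - 1)))"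
  have val: "Re (barnes_G_partial N (of_real t)) = exp (a * (t - 1) - b * (t - 1)\<^sup>2) * (\<Prod>k<N. f k t)" for t
  proof -
    have "barnes_partial N (of_real t - 1) = of_real (\<Prod>k<N. f k t)"
      using barnes_partial_of_real[of N "t - 1"] unfolding f_def by (simp only: of_real_diff of_real_1)
    thus ?thesis
      by (simp add: barnes_G_partial_def barnes_prefactor_of_real a_def b_def flip: of_real_prod)
  qed
  have base: "1 + (t - 1) / real (Suc k) = (real k + t) / real (Suc k)" for k t
    by (simp add: field_simps)
  have fpos: "f k t > 0" if "t > 0" for k t
    unfolding f_def base using that by (intro mult_pos_pos zero_less_power divide_pos_pos) auto
  have pos: "Re (barnes_G_partial N (of_real t)) > 0" if "t > 0" for t
    unfolding val using fpos[OF that] by (simp add: prod_pos)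
  have lnf: "ln (f k t) = real (Suc k) * (ln (real k + t) - ln (real (Suc k))) + ((t - 1)\<^sup>2 / (2 * real (Suc k)) - (t - 1))"
    if "t > 0" for k t
    unfolding f_def base using that by (simp add: ln_mult ln_realpow ln_div del: power_Suc of_nat_Suc)
  define g where "g = (\<lambda>t. a * (t - 1) - b * (t - 1)\<^sup>2 +
     (\<Sum>k<N. real (Suc k) * (ln (real k + t) - ln (real (Suc k))) + ((t - 1)\<^sup>2 / (2 * real (Suc k)) - (t - 1))))"
  have g: "ln (Re (barnes_G_partial N (of_real t))) = g t" if "t > 0" for t
  proof -
    have "ln (\<Prod>k<N. f k t) = (\<Sum>k<N. ln (f k t))"
      using fpos[OF that] by (intro ln_prod) (auto simp: less_imp_neq[symmetric])
    moreover have "(\<Prod>k<N. f k t) > 0"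
      using fpos[OF that] by (intro prod_pos) auto
    ultimately show ?thesis
      unfolding val g_def using lnf[OF that] by (simp add: ln_mult_pos)
  qed
  have "ln_deriv3 (barnes_G_partial N) t = (deriv ^^ 3) (\<lambda>t. ln (Re (barnes_G_partial N (of_real t)))) t"
    using deriv_3_ln_real[OF barnes_G_partial_holomorphic pos assms] by simp
  also have "\<dots> = (\<Sum>k<N. 2 * real (Suc k) / (real k + t) ^ 3)"
  proof (rule deriv_3_eq)
    show "open {0::real<..}" "t \<in> {0<..}" using assms by auto
  next
    fix t :: real assume "t \<in> {0<..}"
    hence t: "t > 0" by simp
    have kt: "real k + t > 0" for k using t by (intro add_nonneg_pos) auto
    have "(g has_real_derivative a - 2 * b * (t - 1)
        + (\<Sum>k<N. real (Suc k) / (real k + t) + ((t - 1) / real (Suc k) - 1))) (at t)"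
      unfolding g_def using kt
      by (auto intro!: derivative_eq_intros sum.cong simp: field_simps simp del: of_nat_Suc)
    moreover have "\<forall>\<^sub>F u in nhds t. ln (Re (barnes_G_partial N (of_real u))) = g u"
      using eventually_nhds_in_open[of "{0<..}" t] t by (auto elim!: eventually_mono simp: g)
    ultimately show "((\<lambda>t. ln (Re (barnes_G_partial N (of_real t)))) has_real_derivative a - 2 * b * (t - 1)
        + (\<Sum>k<N. real (Suc k) / (real k + t) + ((t - 1) / real (Suc k) - 1))) (at t)"
      by (subst DERIV_cong_ev[OF refl _ refl])
    show "((\<lambda>t. a - 2 * b * (t - 1) + (\<Sum>k<N. real (Suc k) / (real k + t) + ((t - 1) / real (Suc k) - 1)))
       has_real_derivative - 2 * b + (\<Sum>k<N. 1 / real (Suc k) - real (Suc k) / (real k + t)\<^sup>2)) (at t)"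
      using kt[THEN less_imp_neq]
      by (auto intro!: derivative_eq_intros sum.cong simp: field_simps power2_eq_square simp del: of_nat_Suc)
    show "((\<lambda>t. - 2 * b + (\<Sum>k<N. 1 / real (Suc k) - real (Suc k) / (real k + t)\<^sup>2))
       has_real_derivative (\<Sum>k<N. 2 * real (Suc k) / (real k + t) ^ 3)) (at t)"
    proof -
      have "((\<lambda>t. 1 / real (Suc k) - real (Suc k) / (real k + t)\<^sup>2)
          has_real_derivative 2 * real (Suc k) / (real k + t) ^ 3) (at t)" for k
      proof (rule DERIV_cong)
        show "((\<lambda>t. 1 / real (Suc k) - real (Suc k) / (real k + t)\<^sup>2) has_real_derivative
          0 - (0 * (real k + t)\<^sup>2 - real (Suc k) * (2 * (real k + t))) / ((real k + t)\<^sup>2 * (real k + t)\<^sup>2)) (at t)"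
          using kt[of k] by (auto intro!: derivative_eq_intros simp del: of_nat_Suc)
        have "0 - (0 * u\<^sup>2 - m * (2 * u)) / (u\<^sup>2 * u\<^sup>2) = 2 * m / u ^ 3" if "u \<noteq> 0" for u m :: real
          using that by (simp add: divide_simps power2_eq_square power3_eq_cube)
        thus "0 - (0 * (real k + t)\<^sup>2 - real (Suc k) * (2 * (real k + t))) / ((real k + t)\<^sup>2 * (real k + t)\<^sup>2)
          = 2 * real (Suc k) / (real k + t) ^ 3"
          using kt[of k] by (metis less_irrefl)
      qed
      hence "((\<lambda>t. \<Sum>k<N. 1 / real (Suc k) - real (Suc k) / (real k + t)\<^sup>2)
          has_real_derivative (\<Sum>k<N. 2 * real (Suc k) / (real k + t) ^ 3)) (at t)"
        by (intro DERIV_sum)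
      from DERIV_add[OF DERIV_const[of "- 2 * b"] this] show ?thesis by simp
    qed
  qed
  also have "\<dots> \<ge> 0"
    using assms by (intro sum_nonneg divide_nonneg_nonneg zero_le_power) auto
  finally show ?thesis .
qed

lemma is_barnes_G_product: "is_barnes_G barnes_G_product"
  unfolding is_barnes_G_def
proof (intro conjI allI impI)
  show "barnes_G_product holomorphic_on UNIV"
    by (rule barnes_G_product_holomorphic)
  have "barnes_prod 0 = 1"
    by (simp add: barnes_prod_def)
  thus "barnes_G_product 1 = 1"
    by (simp add: barnes_G_product_def barnes_prefactor_def)
next
  fix z :: complex assume z: "z \<notin> \<int>\<^sub>\<le>\<^sub>0"
  define w where "w = Re (barnes_prod 1)"
  have w: "w > 0" "barnes_prod 1 = of_real w"
    using barnes_prod_of_real[of 1] by (auto simp: w_def elim!: Reals_cases)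
  define g :: complex where "g = of_real euler_mascheroni"
  have pre: "barnes_prefactor u = exp (((1 + g) / 2 - of_real (ln w)) * (u - 1) - (1 + g) / 2 * (u - 1)\<^sup>2)" for u
    by (simp add: barnes_prefactor_def w_def g_def)
  have "exp (complex_of_real (ln w)) = barnes_prod 1"
    using w by (simp add: exp_of_real)
  hence "barnes_prefactor (z + 1) * barnes_prod 1 * exp ((1 + g) * (z - 1))
     = exp (((1 + g) / 2 - of_real (ln w)) * z - (1 + g) / 2 * z\<^sup>2 + of_real (ln w) + (1 + g) * (z - 1))"
    by (simp add: pre exp_add)
  \<comment> \<open>The coefficients of the prefactor are chosen for this identity: the quadratic
    one balances the exponential of the shift identity, and \<open>- ln w\<close> balances
    \<open>barnes_prod 1\<close>.\<close>
  also have "((1 + g) / 2 - of_real (ln w)) * z - (1 + g) / 2 * z\<^sup>2 + of_real (ln w) + (1 + g) * (z - 1)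
     = ((1 + g) / 2 - of_real (ln w)) * (z - 1) - (1 + g) / 2 * (z - 1)\<^sup>2"
    by (simp add: field_simps power2_eq_square)
  also have "exp \<dots> = barnes_prefactor z"
    by (simp add: pre)
  finally have "barnes_prefactor (z + 1) * barnes_prod 1 * exp ((1 + g) * (z - 1)) = barnes_prefactor z" .
  moreover have "barnes_G_product (z + 1) = barnes_prefactor (z + 1) * barnes_prod 1 * exp ((1 + g) * (z - 1))
      * barnes_prod (z - 1) * Gamma z"
    using barnes_prod_shift[OF z] by (simp add: barnes_G_product_def g_def mult_ac)
  ultimately show "barnes_G_product (z + 1) = barnes_G_product z * Gamma z"
    by (simp add: barnes_G_product_def)
next
  fix x :: real assume x: "x > 0"
  show "barnes_G_product (of_real x) \<in> \<real>" "Re (barnes_G_product (of_real x)) > 0"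
    using barnes_G_product_of_real[OF x] by auto
  have lim: "(\<lambda>N. real_deriv (barnes_G_partial N) n x) \<longlonglongrightarrow> real_deriv barnes_G_product n x" for n
    unfolding real_deriv_def
  proof (intro tendsto_Re higher_deriv_complex_uniform_limit)
    show "uniform_limit (ball (of_real x) 1) barnes_G_partial barnes_G_product sequentially"
      by (rule uniform_limit_on_subset[OF uniform_limit_barnes_G_partial ball_subset_cball])
  qed (auto intro!: always_eventually barnes_G_partial_holomorphic)
  \<comment> \<open>The denominators are powers of the limit's value at \<open>x\<close>, which is
    positive, so the quotients converge.\<close>
  have "(\<lambda>N. ln_deriv3 (barnes_G_partial N) x) \<longlonglongrightarrow> ln_deriv3 barnes_G_product x"
    unfolding ln_deriv3_def
    using barnes_G_product_of_real(2)[OF x] by (intro tendsto_intros lim) auto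
  hence "ln_deriv3 barnes_G_product x \<ge> 0"
    by (rule LIMSEQ_le_const) (use ln_deriv3_barnes_G_partial_nonneg[OF x] in auto)
  thus "(deriv ^^ 3) (\<lambda>t. ln (Re (barnes_G_product (of_real t)))) x \<ge> 0"
    using deriv_3_ln_real[OF barnes_G_product_holomorphic barnes_G_product_of_real(2) x] by simp
qed

lemma barnes_G_eq_product: "barnes_G = barnes_G_product"
  unfolding barnes_G_def
  using is_barnes_G_product is_barnes_G_unique by (intro the_equality) auto

text \<open>The product is evaluated at \<open>x - 1/2\<close>, \<open>x\<close> and
  \<open>-1/2\<close>. The first is the sum of the other two, so linear exponents cancel, and
  \<open>(x - 1/2)^2 - x^2 - 1/4 = - x\<close> leaves \<open>exp (d * x)\<close>.\<close>

lemma barnes_G_ratio: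
  "(barnes_G (x + 1 / 2) / (barnes_G (x + 1) * barnes_G (1 / 2)))\<^sup>2 =
    (barnes_prod (x - 1 / 2) / (barnes_prod x * barnes_prod (- 1 / 2)))\<^sup>2 * exp ((1 + of_real euler_mascheroni) * x)"
proof -
  define c d :: complex where "c = of_real ((1 + euler_mascheroni) / 2 - ln (Re (barnes_prod 1)))"
    and "d = of_real ((1 + euler_mascheroni) / 2)"
  have pre: "barnes_prefactor u = exp (c * (u - 1) - d * (u - 1)\<^sup>2)" for u
    by (simp add: barnes_prefactor_def c_def d_def)
  have "barnes_prefactor (x + 1 / 2) / (barnes_prefactor (x + 1) * barnes_prefactor (1 / 2)) = exp (d * x)"
    unfolding pre exp_add [symmetric] exp_diff [symmetric]
    by (rule arg_cong[of _ _ exp]) (simp add: field_simps power2_eq_square)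
  moreover have "exp (d * x) ^ 2 = exp ((1 + of_real euler_mascheroni) * x)"
  proof -
    have "2 * d = 1 + of_real euler_mascheroni"
      by (simp add: d_def)
    thus ?thesis
      by (metis exp_double mult.assoc)
  qed
  moreover have "barnes_G (x + 1 / 2) / (barnes_G (x + 1) * barnes_G (1 / 2)) =
     (barnes_prod (x - 1 / 2) / (barnes_prod x * barnes_prod (- 1 / 2))) *
     (barnes_prefactor (x + 1 / 2) / (barnes_prefactor (x + 1) * barnes_prefactor (1 / 2)))"
    by (simp add: barnes_G_eq_product barnes_G_product_def mult_ac)
  ultimately show ?thesis
    by (simp only: power_mult_distrib)
qed

subsection \<open>The alternating product\<close>

text \<open>The even index \<open>2 * n\<close> contributes \<open>(1 + x / n)^(- 2 * n)\<close>,
  matching the squared factor at \<open>x\<close>. The odd index \<open>2 * n - 1\<close> has base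
  \<open>(1 + (x - 1/2) / n) / (1 - 1 / (2 * n))\<close>, but an exponent one short of
  \<open>2 * n\<close>; the Pochhammer symbols supply the missing power.\<close>

lemma alternating_product_eq:
  fixes x :: complex
  assumes x: "\<And>k::nat. k > 0 \<Longrightarrow> of_nat k + 2 * x \<noteq> 0"
  shows "(\<Prod>k=1..2 * N. (1 + 2 * x / of_nat k) powi (- int k * (-1) ^ k)) *
    ((barnes_partial N x * barnes_partial N (- 1 / 2))\<^sup>2 * pochhammer (x + 1 / 2) N) =
    (barnes_partial N (x - 1 / 2))\<^sup>2 * pochhammer (1 / 2) N * exp (x * harm N)"
proof (induction N)
  case 0
  thus ?case by (simp add: barnes_partial_def harm_def)
next
  case (Suc N)
  define P where "P = (\<lambda>N. \<Prod>k=1..2 * N. (1 + 2 * x / of_nat k) powi (- int k * (-1) ^ k))"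
  define n :: complex where "n = of_nat (Suc N)"
  \<comment> \<open>Half of the odd index \<open>2 * N + 1\<close>, as \<open>n\<close> is half of
    the even index \<open>2 * N + 2\<close>.\<close>
  define c where "c = n - 1 / 2"
  have n: "n \<noteq> 0" "of_nat N = n - 1" by (simp_all add: n_def del: of_nat_Suc) simp
  have c2: "of_nat (2 * N + 1) = 2 * c" by (simp add: c_def n_def)
  have n2: "of_nat (2 * Suc N) = 2 * n" by (simp add: n_def)
  have c: "c \<noteq> 0"
    using c2 of_nat_neq_0[of "2 * N", where ?'a = complex] by auto
  have cx: "c + x \<noteq> 0"
    using x[of "2 * N + 1"] unfolding c2 distrib_left [symmetric] by (simp del: distrib_left_numeral)
  have nx: "n + x \<noteq> 0"
    proof -
    have "2 * (n + x) = of_nat (2 * Suc N) + 2 * x"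
      by (simp add: n_def)
    hence "2 * (n + x) \<noteq> 0"
      using x[of "2 * Suc N"] by (simp only:) simp
    thus ?thesis by (metis mult_zero_right)
  qed
  have P: "P (Suc N) = P N * ((c + x) / c) ^ (2 * N + 1) / ((n + x) / n) ^ (2 * N + 2)"
  proof -
    have "P (Suc N) = P N * (1 + 2 * x / of_nat (2 * N + 1)) powi (- int (2 * N + 1) * (-1) ^ (2 * N + 1))
       * (1 + 2 * x / of_nat (2 * Suc N)) powi (- int (2 * Suc N) * (-1) ^ (2 * Suc N))"
      by (simp add: P_def prod.nat_ivl_Suc' mult_ac)
    also have "- int (2 * N + 1) * (-1) ^ (2 * N + 1) = int (2 * N + 1)"
      by simp
    also have "- int (2 * Suc N) * (-1) ^ (2 * Suc N) = - int (2 * N + 2)"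
      by simp
    also have "1 + 2 * x / of_nat (2 * N + 1) = (c + x) / c"
      unfolding c2 using c by (simp add: field_simps)
    also have "1 + 2 * x / of_nat (2 * Suc N) = (n + x) / n"
      unfolding n2 using n by (simp add: field_simps)
    finally show ?thesis
      by (simp only: power_int_minus power_int_of_nat divide_inverse)
  qed
  have base: "1 + x / n = (n + x) / n" "1 + (- 1 / 2) / n = c / n" "1 + (x - 1 / 2) / n = (c + x) / n"
    using n by (simp_all add: c_def field_simps)
  have sq: "(u ^ Suc N)\<^sup>2 = u ^ (2 * N + 2)" for u :: complex
    by (simp add: power_mult [symmetric] mult.commute del: power_Suc)
  have esq: "(exp u)\<^sup>2 = exp (2 * u)" for u :: complex
    by (simp add: exp_double)
  have fac: "(barnes_factor N x)\<^sup>2 = ((n + x) / n) ^ (2 * N + 2) * exp (2 * (x\<^sup>2 / (2 * n) - x))"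
    "(barnes_factor N (- 1 / 2))\<^sup>2 = (c / n) ^ (2 * N + 2) * exp (2 * ((- 1 / 2)\<^sup>2 / (2 * n) - - 1 / 2))"
    "(barnes_factor N (x - 1 / 2))\<^sup>2 = ((c + x) / n) ^ (2 * N + 2) * exp (2 * ((x - 1 / 2)\<^sup>2 / (2 * n) - (x - 1 / 2)))"
    unfolding barnes_factor_altdef n_def [symmetric] base power_mult_distrib sq esq by simp_all
  \<comment> \<open>The surplus \<open>x / n\<close> of each step accumulates to
    \<open>x * harm N\<close>.\<close>
  have ex: "2 * (x\<^sup>2 / (2 * n) - x) + 2 * ((- 1 / 2)\<^sup>2 / (2 * n) - - 1 / 2)
     = 2 * ((x - 1 / 2)\<^sup>2 / (2 * n) - (x - 1 / 2)) + x / n"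
    using n by (simp add: field_simps power2_eq_square)
  have hs: "x * harm (Suc N) = x * harm N + x / n"
    by (simp add: harm_Suc n_def divide_inverse ring_distribs)
  have key: "((c + x) / c) ^ (2 * N + 1) / ((n + x) / n) ^ (2 * N + 2) *
     ((barnes_factor N x)\<^sup>2 * (barnes_factor N (- 1 / 2))\<^sup>2 * (c + x)) =
     (barnes_factor N (x - 1 / 2))\<^sup>2 * c * exp (x / n)"
  proof -
    have "((c + x) / c) ^ (2 * N + 1) / ((n + x) / n) ^ (2 * N + 2) *
     ((barnes_factor N x)\<^sup>2 * (barnes_factor N (- 1 / 2))\<^sup>2 * (c + x)) =
      ((c + x) / c) ^ (2 * N + 1) * (c / n) ^ (2 * N + 2) * (c + x) *
      exp (2 * (x\<^sup>2 / (2 * n) - x) + 2 * ((- 1 / 2)\<^sup>2 / (2 * n) - - 1 / 2))"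
      unfolding fac exp_add using nx n(1) by simp
    \<comment> \<open>The Pochhammer factor \<open>c + x\<close> raises the odd exponent to
      \<open>2 * N + 2\<close>, and the unmatched \<open>c\<close> is the factor of the other
      Pochhammer symbol.\<close>
    also have "((c + x) / c) ^ (2 * N + 1) * (c / n) ^ (2 * N + 2) * (c + x) = ((c + x) / n) ^ (2 * N + 2) * c"
      using c n(1) by (simp add: power_divide field_simps)
    finally show ?thesis
      unfolding ex fac exp_add by (simp only: mult_ac)
  qed
  have poch: "pochhammer (x + 1 / 2) (Suc N) = pochhammer (x + 1 / 2) N * (c + x)"
    "pochhammer (1 / 2) (Suc N) = pochhammer (1 / 2) N * c"
    by (simp_all add: pochhammer_Suc c_def n algebra_simps)
  define K where "K = ((c + x) / c) ^ (2 * N + 1) / ((n + x) / n) ^ (2 * N + 2)"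
  have "P (Suc N) * ((barnes_partial (Suc N) x * barnes_partial (Suc N) (- 1 / 2))\<^sup>2 * pochhammer (x + 1 / 2) (Suc N))
    = (P N * ((barnes_partial N x * barnes_partial N (- 1 / 2))\<^sup>2 * pochhammer (x + 1 / 2) N)) *
      (K * ((barnes_factor N x)\<^sup>2 * (barnes_factor N (- 1 / 2))\<^sup>2 * (c + x)))"
    unfolding P poch barnes_partial_Suc K_def by (simp only: power_mult_distrib times_divide_eq_right times_divide_eq_left mult_ac)
  also have "\<dots> = ((barnes_partial N (x - 1 / 2))\<^sup>2 * pochhammer (1 / 2) N * exp (x * harm N)) *
      ((barnes_factor N (x - 1 / 2))\<^sup>2 * c * exp (x / n))"
    using Suc.IH key by (simp only: P_def K_def)
  also have "\<dots> = (barnes_partial (Suc N) (x - 1 / 2))\<^sup>2 * pochhammer (1 / 2) (Suc N) * exp (x * harm (Suc N))"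
    unfolding poch barnes_partial_Suc hs exp_add by (simp only: power_mult_distrib mult_ac)
  finally show ?case
    unfolding P_def .
qed

theorem proposition5:
  fixes x :: complex
  assumes "Re x > - 1 / 2"
  shows "(\<lambda>N::nat. \<Prod>k=1..2 * N. (1 + 2 * x / of_nat k) powi (- int k * (-1) ^ k))
     \<longlonglongrightarrow> exp (- x) * Gamma (x + 1 / 2) / Gamma (1 / 2) *
       (barnes_G (x + 1 / 2) / (barnes_G (x + 1) * barnes_G (1 / 2))) ^ 2"
proof -
  let ?P = "\<lambda>N::nat. \<Prod>k=1..2 * N. (1 + 2 * x / of_nat k) powi (- int k * (-1) ^ k)"
  \<comment> \<open>A regrouping into convergent pieces: the quotient of Gauss products contributes
    \<open>N^x\<close>, which is compensated by subtracting \<open>ln N\<close> from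
    \<open>harm N\<close>.\<close>
  let ?Q = "\<lambda>N::nat. (barnes_partial N (x - 1 / 2) / (barnes_partial N x * barnes_partial N (- 1 / 2)))\<^sup>2 *
       (Gamma_series' (x + 1 / 2) N / Gamma_series' (1 / 2) N) * exp (x * (harm N - of_real (ln (real N))))"
  \<comment> \<open>The real part exceeds \<open>k - 1\<close>, which is nonnegative.\<close>
  have nz: "of_nat k + 2 * x \<noteq> 0" if "k > 0" for k
  proof -
    have "Re (of_nat k + 2 * x) > 0" using assms that by simp
    thus ?thesis by (metis less_irrefl zero_complex.simps(1))
  qed
  have nI: "z \<noteq> - of_nat (Suc k)" if "Re z > -1" for z :: complex and k
  proof
    assume "z = - of_nat (Suc k)"
    hence "Re z = - real (Suc k)" by simp
    thus False using that by simp
  qed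
  have rx: "Re x > -1" "Re (- 1 / 2) > -1"
    using assms by auto
  have pos: "z \<notin> \<int>\<^sub>\<le>\<^sub>0" if "Re z > 0" for z :: complex
    using that by (auto elim!: nonpos_Ints_cases')
  have half: "x + 1 / 2 \<notin> \<int>\<^sub>\<le>\<^sub>0" "1 / 2 \<notin> (\<int>\<^sub>\<le>\<^sub>0 :: complex set)"
    using assms by (auto intro!: pos)
  have eq: "?Q N = ?P N" if N: "N > 0" for N
  proof -
    have p: "pochhammer (x + 1 / 2) N \<noteq> 0" "pochhammer (1 / 2 :: complex) N \<noteq> 0"
      using half by (auto dest: pochhammer_eq_0_imp_nonpos_Int)
    have b: "barnes_partial N x \<noteq> 0" "barnes_partial N (- 1 / 2) \<noteq> 0"
      using nI rx by (intro barnes_partial_nonzero; blast)+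
    have G: "Gamma_series' (x + 1 / 2) N / Gamma_series' (1 / 2) N * exp (x * (harm N - of_real (ln (real N))))
       = pochhammer (1 / 2) N / pochhammer (x + 1 / 2) N * exp (x * harm N)"
      using p by (simp add: Gamma_series'_def ring_distribs exp_add exp_diff)
    have "?Q N = (barnes_partial N (x - 1 / 2))\<^sup>2 * pochhammer (1 / 2) N * exp (x * harm N) /
       ((barnes_partial N x * barnes_partial N (- 1 / 2))\<^sup>2 * pochhammer (x + 1 / 2) N)"
      unfolding mult.assoc G by (simp add: power_divide)
    also have "\<dots> = ?P N"
    proof -
      have "(barnes_partial N x * barnes_partial N (- 1 / 2))\<^sup>2 * pochhammer (x + 1 / 2) N \<noteq> 0"
        using b p by simp
      thus ?thesis
        by (subst nonzero_divide_eq_eq) (simp_all only: alternating_product_eq[OF nz] not_False_eq_True)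
    qed
    finally show ?thesis .
  qed
  have bp: "barnes_prod x \<noteq> 0" "barnes_prod (- 1 / 2) \<noteq> 0"
    using nI rx by (intro barnes_prod_nonzero; blast)+
  have "?Q \<longlonglongrightarrow> (barnes_prod (x - 1 / 2) / (barnes_prod x * barnes_prod (- 1 / 2)))\<^sup>2 *
       (Gamma (x + 1 / 2) / Gamma (1 / 2)) * exp (x * of_real euler_mascheroni)"
    using bp half by (intro tendsto_intros barnes_partial_LIMSEQ Gamma_series'_LIMSEQ harm_minus_ln_LIMSEQ)
      (auto simp: Gamma_eq_zero_iff)
  moreover have "\<forall>\<^sub>F N in sequentially. ?Q N = ?P N"
    using eventually_gt_at_top[of 0] by eventually_elim (rule eq)
  ultimately have "?P \<longlonglongrightarrow> (barnes_prod (x - 1 / 2) / (barnes_prod x * barnes_prod (- 1 / 2)))\<^sup>2 *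
       (Gamma (x + 1 / 2) / Gamma (1 / 2)) * exp (x * of_real euler_mascheroni)"
    by (rule Lim_transform_eventually)
  \<comment> \<open>The ratio of Barnes values absorbs
    \<open>exp ((1 + euler_mascheroni) * x)\<close>; what is left over is the factor
    \<open>exp (- x)\<close>.\<close>
  also have "exp (x * of_real euler_mascheroni) = exp (- x) * exp ((1 + of_real euler_mascheroni) * x)"
    by (simp add: exp_add [symmetric] algebra_simps)
  finally show ?thesis
    unfolding barnes_G_ratio by (simp add: mult_ac)
qed

end
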